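(* Every interval $I$ in a Tamari lattice $Y_n$ ($n\ge1$) has a unique maximal decomposition $I=I_1/I_2/\cdots/I_k$.
   Context: Planar binary trees have internal vertices of valence $3$, a root at the bottom and leaves at the top. $Y_n$ is the set of planar binary trees with $n\ge1$ internal vertices; $|$ is the trivial tree with one leaf and no internal vertex. $S\vee T$ is the tree whose bottom internal vertex has left subtree $S$ and right subtree $T$ ($S,T$ possibly trivial). $S/T$ is obtained by identifying the root of $S$ with the leftmost leaf of $T$; this operation is associative. Tamari order on $Y_n$: $S\leq T$ iff one can pass from $S$ to $T$ by a (possibly empty) sequence of replacements of a subtree $A\vee(B\vee C)$ by $(A\vee B)\vee C$ ($A,B,C$ possibly trivial). An interval in $Y_n$ is $[S,T]$ with $S\le T$ in $Y_n$; its minimum is $S$ and its maximum is $T$. For intervals $J$ in $Y_m$ and $K$ in $Y_n$ ($m,n\ge1$), $J/K$ is the interval in $Y_{m+n}$ with $\min(J/K)=\min(J)/\min(K)$ and $\max(J/K)=\max(J)/\max(K)$; this operation is associative. A decomposition of $I$ is a finite sequence of intervals $(I_1,\dots,I_k)$, $k\ge1$, in lattices $Y_{n_i}$ with $n_i\ge1$, such that $I=I_1/\cdots/I_k$; it is maximal if it cannot be refined, i.e. no $I_i$ is itself of the form $J/K$ with $J$ an interval in $Y_p$ and $K$ an interval in $Y_q$ for some $p,q\ge1$. *)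

theory Defs
  imports Main
begin

text \<open>The trivial tree is \<open>Leaf\<close>, and \<open>Vee S T\<close> is \<open>S \<or> T\<close>. The size function generated by
  the datatype package gives \<open>Leaf\<close> size \<open>0\<close> and adds \<open>1\<close> for every \<open>Vee\<close>, so it counts
  internal vertices.\<close>

datatype pbtree = Leaf | Vee pbtree pbtree

definition Y :: "nat \<Rightarrow> pbtree set" where
  "Y n = {T. size T = n}"

text \<open>\<open>over S T\<close> is \<open>S/T\<close>: the root of \<open>S\<close> is glued to the leftmost leaf of \<open>T\<close>.\<close>

fun over :: "pbtree \<Rightarrow> pbtree \<Rightarrow> pbtree" where
  "over S Leaf = S"
| "over S (Vee T U) = Vee (over S T) U"

text \<open>\<open>rotation S T\<close>: \<open>T\<close> arises from \<open>S\<close> by replacing one subtree, at any position.\<close>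

inductive rotation :: "pbtree \<Rightarrow> pbtree \<Rightarrow> bool" where
  root: "rotation (Vee A (Vee B C)) (Vee (Vee A B) C)"
| left: "rotation S S' \<Longrightarrow> rotation (Vee S T) (Vee S' T)"
| right: "rotation T T' \<Longrightarrow> rotation (Vee S T) (Vee S T')"

text \<open>Sum of the sizes of the left subtrees at all vertices. Rotations increase it strictly,
  so the Tamari relation is antisymmetric.\<close>

fun left_weight :: "pbtree \<Rightarrow> nat" where
  "left_weight Leaf = 0"
| "left_weight (Vee S T) = size S + left_weight S + left_weight T"

lemma rotation_size: "rotation S T \<Longrightarrow> size S = size T"
  by (induction rule: rotation.induct) auto

lemma rotation_left_weight: "rotation S T \<Longrightarrow> left_weight S < left_weight T"
  by (induction rule: rotation.induct) (auto dest: rotation_size)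

lemma rotations_left_weight:
  "rotation\<^sup>*\<^sup>* S T \<Longrightarrow> S = T \<or> left_weight S < left_weight T"
  by (induction rule: rtranclp_induct) (auto dest: rotation_left_weight)

text \<open>The Tamari orders on all \<open>Y n\<close> together: rotations preserve the size, so trees of different
  sizes are incomparable and \<open>{S..T}\<close> lies in a single \<open>Y n\<close>.\<close>

instantiation pbtree :: order
begin

definition less_eq_pbtree :: "pbtree \<Rightarrow> pbtree \<Rightarrow> bool" where
  "S \<le> T \<longleftrightarrow> rotation\<^sup>*\<^sup>* S T"

definition less_pbtree :: "pbtree \<Rightarrow> pbtree \<Rightarrow> bool" where
  "S < T \<longleftrightarrow> S \<le> T \<and> \<not> T \<le> (S :: pbtree)"

instance
proof
  fix S T U :: pbtree
  show "S < T \<longleftrightarrow> S \<le> T \<and> \<not> T \<le> S" by (rule less_pbtree_def)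
  show "S \<le> S" by (simp add: less_eq_pbtree_def)
  show "S \<le> U" if "S \<le> T" "T \<le> U" using that by (simp add: less_eq_pbtree_def)
  show "S = T" if "S \<le> T" "T \<le> S"
    using that rotations_left_weight[of S T] rotations_left_weight[of T S]
    by (auto simp: less_eq_pbtree_def)
qed

end

lemma tamari_size: "S \<le> T \<Longrightarrow> size S = size T" for S T :: pbtree
  unfolding less_eq_pbtree_def
  by (induction rule: rtranclp_induct) (auto dest: rotation_size)

definition tamari_interval :: "nat \<Rightarrow> pbtree set \<Rightarrow> bool" where
  "tamari_interval n I \<longleftrightarrow> (\<exists>S\<in>Y n. \<exists>T\<in>Y n. S \<le> T \<and> I = {S..T})"

definition int_min :: "pbtree set \<Rightarrow> pbtree" where
  "int_min I = (LEAST S. S \<in> I)"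

definition int_max :: "pbtree set \<Rightarrow> pbtree" where
  "int_max I = (GREATEST T. T \<in> I)"

lemma int_min_atLeastAtMost: "S \<le> T \<Longrightarrow> int_min {S..T} = S"
  unfolding int_min_def by (rule Least_equality) auto

lemma int_max_atLeastAtMost: "S \<le> T \<Longrightarrow> int_max {S..T} = T"
  unfolding int_max_def by (rule Greatest_equality) auto

definition int_over :: "pbtree set \<Rightarrow> pbtree set \<Rightarrow> pbtree set" where
  "int_over J K = {over (int_min J) (int_min K)..over (int_max J) (int_max K)}"

lemma size_over: "size (over S T) = size S + size T"
  by (induction T) auto

lemma over_assoc: "over (over S T) U = over S (over T U)"
  by (induction U) auto

lemma rotation_over_left: "rotation S S' \<Longrightarrow> rotation (over S T) (over S' T)"
  by (induction T) (auto intro: rotation.left)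

lemma rotation_over_right: "rotation T T' \<Longrightarrow> rotation (over S T) (over S T')"
  by (induction rule: rotation.induct) (auto intro: rotation.intros)

lemma over_mono:
  assumes "S \<le> S'" "T \<le> T'"
  shows "over S T \<le> over S' T'"
proof -
  have "rotation\<^sup>*\<^sup>* (over S T) (over S' T)"
    using assms(1) unfolding less_eq_pbtree_def
    by (induction rule: rtranclp_induct) (auto dest: rotation_over_left[where T=T])
  moreover have "rotation\<^sup>*\<^sup>* (over S' T) (over S' T')"
    using assms(2) unfolding less_eq_pbtree_def
    by (induction rule: rtranclp_induct) (auto dest: rotation_over_right[where S=S'])
  ultimately show ?thesis by (simp add: less_eq_pbtree_def)
qed

lemma tamari_interval_int_over:
  assumes "tamari_interval m J" "tamari_interval n K"
  shows "tamari_interval (m + n) (int_over J K)"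
    and "int_min (int_over J K) = over (int_min J) (int_min K)"
    and "int_max (int_over J K) = over (int_max J) (int_max K)"
proof -
  from assms obtain A B C D where
    J: "A \<in> Y m" "B \<in> Y m" "A \<le> B" "J = {A..B}" and
    K: "C \<in> Y n" "D \<in> Y n" "C \<le> D" "K = {C..D}"
    unfolding tamari_interval_def by blast
  have le: "over A C \<le> over B D" using J K by (simp add: over_mono)
  have eq: "int_over J K = {over A C..over B D}"
    using J K by (simp add: int_over_def int_min_atLeastAtMost int_max_atLeastAtMost)
  show "tamari_interval (m + n) (int_over J K)"
    unfolding tamari_interval_def eq
    using J K le by (intro bexI[of _ "over A C"] bexI[of _ "over B D"]) (auto simp: Y_def size_over)
  show "int_min (int_over J K) = over (int_min J) (int_min K)"
    and "int_max (int_over J K) = over (int_max J) (int_max K)"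
    unfolding eq using J(3,4) K(3,4) le
    by (simp_all add: int_min_atLeastAtMost int_max_atLeastAtMost)
qed

lemma int_over_assoc:
  assumes "tamari_interval l J" "tamari_interval m K" "tamari_interval n L"
  shows "int_over (int_over J K) L = int_over J (int_over K L)"
  unfolding int_over_def[of "int_over J K" L] int_over_def[of J "int_over K L"]
  by (simp add: tamari_interval_int_over[OF assms(1,2)] tamari_interval_int_over[OF assms(2,3)]
      over_assoc)

text \<open>The iterated product \<open>I\<^sub>1/\<dots>/I\<^sub>k\<close> for \<open>k \<ge> 1\<close>; it is used only on nonempty lists of
  intervals, where the bracketing does not matter by \<open>int_over_assoc\<close>.\<close>

fun int_over_list :: "pbtree set list \<Rightarrow> pbtree set" where
  "int_over_list [] = undefined"
| "int_over_list [J] = J"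
| "int_over_list (J # K # Js) = int_over J (int_over_list (K # Js))"

definition decomposition :: "pbtree set list \<Rightarrow> pbtree set \<Rightarrow> bool" where
  "decomposition Js I \<longleftrightarrow>
     Js \<noteq> [] \<and> (\<forall>J\<in>set Js. \<exists>n\<ge>1. tamari_interval n J) \<and> I = int_over_list Js"

definition int_decomposable :: "pbtree set \<Rightarrow> bool" where
  "int_decomposable I \<longleftrightarrow>
     (\<exists>p\<ge>1. \<exists>q\<ge>1. \<exists>J K. tamari_interval p J \<and> tamari_interval q K \<and> I = int_over J K)"

definition maximal_decomposition :: "pbtree set list \<Rightarrow> pbtree set \<Rightarrow> bool" where
  "maximal_decomposition Js I \<longleftrightarrow> decomposition Js I \<and> (\<forall>J\<in>set Js. \<not> int_decomposable J)"

end

theory Submission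
  imports Defs
begin

text \<open>Intervals with the product \<open>/\<close>, graded by the number of internal vertices, form a free
  monoid on the indecomposable intervals; as for words, this follows from a Levi lemma: if
  \<open>J/K = J'/K'\<close> and the trees in \<open>J\<close> have at most as many vertices as those in \<open>J'\<close>, then
  \<open>J' = J/L\<close> and \<open>K = L/K'\<close> for some interval \<open>L\<close> (\<open>int_over_levi\<close>). So two indecomposable first factors of the same interval agree,
  and so do the remaining products, which gives uniqueness by induction on the number of factors.
  Existence is splitting as long as possible, which stops because the sizes add up.

  For single trees, the Levi lemma is a matter of reading the path from the root to the leftmost
  leaf, along which the factors of \<open>/\<close> are stacked. Applied to the minima and to the maxima of an
  equation between intervals, it yields trees \<open>X\<close> and \<open>Z\<close> as endpoints of \<open>L\<close>, and the point is
  that \<open>X \<le> Z\<close>. This holds because no rotation can involve both factors of a tree \<open>S/X\<close>: a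
  rotation acts on a vertex and its right child, whereas the edge that joins \<open>S\<close> to \<open>X\<close> is a left
  edge. Hence everything above \<open>S/X\<close> in the Tamari order is of the form \<open>S'/X'\<close> with \<open>S \<le> S'\<close>
  and \<open>X \<le> X'\<close>, and the order can be cancelled factor by factor (\<open>over_le_overD\<close>).\<close>

section \<open>Cancellation for trees\<close>

lemma over_Leaf_left [simp]: "over Leaf T = T"
  by (induction T) auto

lemma size_0_iff_Leaf [simp]: "size T = 0 \<longleftrightarrow> T = Leaf" for T :: pbtree
  by (cases T) auto

text \<open>Removing the common bottom vertices of the two lower factors one by one uses up the smaller
  one first, namely \<open>B'\<close>; what remains of \<open>B\<close> is the overlap \<open>X\<close>.\<close>

lemma over_levi:
  assumes "over A B = over A' B'" and "size A \<le> size A'"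
  obtains X where "A' = over A X" and "B = over X B'"
proof -
  have "\<exists>X. A' = over A X \<and> B = over X B'"
    using assms
  proof (induction B' arbitrary: B)
    case Leaf
    then show ?case by auto
  next
    case (Vee C D)
    show ?case
    proof (cases B)
      case Leaf
      with Vee.prems have "size A = size A' + size (Vee C D)"
        by (metis over.simps(1) size_over)
      with Vee.prems(2) show ?thesis by simp
    next
      case (Vee E F)
      with Vee.prems Vee.IH(1)[of E] show ?thesis by auto
    qed
  qed
  with that show thesis by blast
qed

corollary over_cancel:
  assumes "over A B = over A' B'" and "size A = size A'"
  shows "A = A'" and "B = B'"
proof -
  from assms obtain X where X: "A' = over A X" "B = over X B'"
    by (auto elim: over_levi)
  with assms(2) have "X = Leaf"
    by (simp add: size_over)
  with X show "A = A'" "B = B'" by simp_all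
qed

text \<open>The junction in \<open>over S X\<close> is a left edge, so the vertex of a rotation and its right child
  lie in the same factor. When the vertex is the one onto which \<open>S\<close> is glued, \<open>S\<close> is carried
  along as part of the left subtree, and the rotation still takes place in \<open>X\<close>.\<close>

lemma rotation_over_cases:
  assumes "rotation (over S X) Z"
  obtains (upper) S' where "rotation S S'" "Z = over S' X"
    | (lower) X' where "rotation X X'" "Z = over S X'"
proof -
  have "(\<exists>S'. rotation S S' \<and> Z = over S' X) \<or> (\<exists>X'. rotation X X' \<and> Z = over S X')"
    using assms
  proof (induction X arbitrary: Z)
    case Leaf
    then show ?case by auto
  next
    case (Vee A B)
    from Vee.prems have "rotation (Vee (over S A) B) Z" by simp
    then show ?case
    proof cases
      case (root C D)
      then have "rotation (Vee A B) (Vee (Vee A C) D)" "Z = over S (Vee (Vee A C) D)"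
        by (auto intro: rotation.root)
      then show ?thesis by blast
    next
      case (left L)
      from Vee.IH(1)[OF left(2)] show ?thesis
      proof (elim disjE exE conjE)
        fix S' assume "rotation S S'" "L = over S' A"
        with left(1) have "Z = over S' (Vee A B)" by simp
        with \<open>rotation S S'\<close> show ?thesis by blast
      next
        fix A' assume "rotation A A'" "L = over S A'"
        with left(1) have "rotation (Vee A B) (Vee A' B)" "Z = over S (Vee A' B)"
          by (auto intro: rotation.left)
        then show ?thesis by blast
      qed
    next
      case (right B')
      then have "rotation (Vee A B) (Vee A B')" "Z = over S (Vee A B')"
        by (auto intro: rotation.right)
      then show ?thesis by blast
    qed
  qed
  with upper lower show thesis by blast
qed

lemma rotation_imp_le: "rotation S T \<Longrightarrow> S \<le> T"
  by (simp add: less_eq_pbtree_def r_into_rtranclp)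

lemma over_le_cases:
  assumes "over S X \<le> Z"
  obtains S' X' where "Z = over S' X'" "S \<le> S'" "X \<le> X'"
proof -
  from assms have "rotation\<^sup>*\<^sup>* (over S X) Z"
    by (simp add: less_eq_pbtree_def)
  then have "\<exists>S' X'. Z = over S' X' \<and> S \<le> S' \<and> X \<le> X'"
  proof (induction rule: rtranclp_induct)
    case base
    then show ?case by blast
  next
    case (step U V)
    then obtain S' X' where *: "U = over S' X'" "S \<le> S'" "X \<le> X'" by blast
    with step.hyps(2) have "rotation (over S' X') V" by simp
    then show ?case
      by (cases rule: rotation_over_cases) (use * rotation_imp_le order_trans in blast)+
  qed
  with that show thesis by blast
qed

text \<open>Equal sizes are what makes the factors comparable at all: they force the factors of
  \<open>over T Z\<close> supplied by \<open>over_le_cases\<close> to be \<open>T\<close> and \<open>Z\<close>.\<close>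

lemma over_le_overD:
  assumes "over S X \<le> over T Z" and "size S = size T"
  shows "S \<le> T" and "X \<le> Z"
proof -
  from assms(1) obtain S' X' where *: "over T Z = over S' X'" "S \<le> S'" "X \<le> X'"
    by (rule over_le_cases)
  from \<open>S \<le> S'\<close> assms(2) have "size T = size S'"
    by (simp add: tamari_size)
  from over_cancel[OF *(1) this] * show "S \<le> T" "X \<le> Z" by simp_all
qed

section \<open>Overlaps of interval factorizations\<close>

lemma int_over_atLeastAtMost:
  "A \<le> B \<Longrightarrow> C \<le> D \<Longrightarrow> int_over {A..B} {C..D} = {over A C..over B D}"
  by (simp add: int_over_def int_min_atLeastAtMost int_max_atLeastAtMost)

lemma tamari_interval_size_unique:
  "tamari_interval m I \<Longrightarrow> tamari_interval n I \<Longrightarrow> m = n"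
  unfolding tamari_interval_def Y_def by (metis int_min_atLeastAtMost mem_Collect_eq)

lemma tamari_interval_0: "tamari_interval 0 L \<Longrightarrow> L = {Leaf..Leaf}"
  by (auto simp: tamari_interval_def Y_def)

lemma int_over_Leaf:
  assumes "tamari_interval n J"
  shows "int_over J {Leaf..Leaf} = J" and "int_over {Leaf..Leaf} J = J"
  using assms by (auto simp: tamari_interval_def int_over_def int_min_atLeastAtMost
      int_max_atLeastAtMost[of Leaf Leaf, simplified] int_max_atLeastAtMost
      int_min_atLeastAtMost[of Leaf Leaf, simplified])

text \<open>The tree overlaps \<open>X\<close> of the minima and \<open>Z\<close> of the maxima bound an interval because
  \<open>A/X \<le> B/Z\<close> can be cancelled.\<close>

lemma int_over_levi:
  assumes J: "tamari_interval p J" and K: "tamari_interval q K"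
    and J': "tamari_interval p' J'" and K': "tamari_interval q' K'"
    and eq: "int_over J K = int_over J' K'" and "p \<le> p'"
  obtains L where "tamari_interval (p' - p) L" "J' = int_over J L" "K = int_over L K'"
proof -
  from J obtain A B where J: "size A = p" "size B = p" "A \<le> B" "J = {A..B}"
    by (auto simp: tamari_interval_def Y_def)
  from K obtain C D where K: "C \<le> D" "K = {C..D}"
    by (auto simp: tamari_interval_def)
  from J' obtain A' B' where J': "size A' = p'" "size B' = p'" "A' \<le> B'" "J' = {A'..B'}"
    by (auto simp: tamari_interval_def Y_def)
  from K' obtain C' D' where K': "C' \<le> D'" "K' = {C'..D'}"
    by (auto simp: tamari_interval_def)
  have "{over A C..over B D} = {over A' C'..over B' D'}"
    using eq J K J' K' by (simp add: int_over_atLeastAtMost)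
  moreover have "over A C \<le> over B D"
    using J K by (simp add: over_mono)
  ultimately have "over A C = over A' C'" "over B D = over B' D'"
    by (simp_all add: Icc_eq_Icc)
  then obtain X Z where X: "A' = over A X" "C = over X C'" and Z: "B' = over B Z" "D = over Z D'"
    using J J' \<open>p \<le> p'\<close> by (metis over_levi)
  from J' X Z have "over A X \<le> over B Z" by simp
  with J have "X \<le> Z" by (auto dest: over_le_overD)
  show thesis
  proof (rule that)
    show "tamari_interval (p' - p) {X..Z}"
      using J J' X Z \<open>X \<le> Z\<close> by (auto simp: tamari_interval_def Y_def size_over)
    show "J' = int_over J {X..Z}" "K = int_over {X..Z} K'"
      using J J' K K' X Z \<open>X \<le> Z\<close> by (simp_all add: int_over_atLeastAtMost)
  qed
qed

text \<open>The smaller of two first factors is a prefix of the larger one, which an indecomposable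
  interval allows only if the overlap is trivial.\<close>

lemma int_over_indecomposable_cancel_le:
  assumes "tamari_interval p J" "p \<ge> 1" and "tamari_interval q K"
    and "tamari_interval p' J'" "\<not> int_decomposable J'" and "tamari_interval q' K'"
    and "int_over J K = int_over J' K'" and "p \<le> p'"
  shows "J = J'" and "K = K'"
proof -
  obtain L where L: "tamari_interval (p' - p) L" "J' = int_over J L" "K = int_over L K'"
    using assms by (metis int_over_levi)
  have "p' - p = 0"
    using assms(1,2,5) L(1,2) unfolding int_decomposable_def
    by (metis not_less_eq_eq One_nat_def le_zero_eq)
  with L(1) have "L = {Leaf..Leaf}"
    by (auto dest: tamari_interval_0)
  with L(2,3) int_over_Leaf(1)[OF assms(1)] int_over_Leaf(2)[OF assms(6)]
  show "J = J'" "K = K'" by simp_all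
qed

lemma int_over_indecomposable_cancel:
  assumes "tamari_interval p J" "p \<ge> 1" "\<not> int_decomposable J" and "tamari_interval q K"
    and "tamari_interval p' J'" "p' \<ge> 1" "\<not> int_decomposable J'" and "tamari_interval q' K'"
    and "int_over J K = int_over J' K'"
  shows "J = J'" and "K = K'"
proof -
  have "J = J' \<and> K = K'"
  proof (cases "p \<le> p'")
    case True
    with assms int_over_indecomposable_cancel_le[of p J q K p' J' q' K'] show ?thesis by blast
  next
    case False
    then have "p' \<le> p" by simp
    with assms int_over_indecomposable_cancel_le[of p' J' q' K' p J q K] show ?thesis by metis
  qed
  then show "J = J'" "K = K'" by simp_all
qed

section \<open>Existence and uniqueness of maximal decompositions\<close>

lemma int_over_list_Cons: "Js \<noteq> [] \<Longrightarrow> int_over_list (J # Js) = int_over J (int_over_list Js)"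
  by (cases Js) auto

lemma tamari_interval_int_over_list:
  assumes "Js \<noteq> []" "\<forall>J\<in>set Js. \<exists>n\<ge>1. tamari_interval n J"
  shows "\<exists>n\<ge>1. tamari_interval n (int_over_list Js)"
  using assms
proof (induction Js rule: list_nonempty_induct)
  case (single J)
  then show ?case by simp
next
  case (cons J Js)
  then obtain m n where "m \<ge> 1" "tamari_interval m J"
    and "n \<ge> 1" "tamari_interval n (int_over_list Js)" by auto
  then have "tamari_interval (m + n) (int_over_list (J # Js))" "m + n \<ge> 1"
    using cons.hyps by (simp_all add: int_over_list_Cons tamari_interval_int_over(1))
  then show ?case by blast
qed

lemma int_over_list_append:
  assumes "Js \<noteq> []" "\<forall>J\<in>set Js. \<exists>n\<ge>1. tamari_interval n J"
    and "Ks \<noteq> []" "\<forall>J\<in>set Ks. \<exists>n\<ge>1. tamari_interval n J"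
  shows "int_over_list (Js @ Ks) = int_over (int_over_list Js) (int_over_list Ks)"
  using assms(1,2)
proof (induction Js rule: list_nonempty_induct)
  case (single J)
  with assms(3) show ?case by (simp add: int_over_list_Cons)
next
  case (cons J Js)
  then obtain l m n where "tamari_interval l J" "tamari_interval m (int_over_list Js)"
    "tamari_interval n (int_over_list Ks)"
    using tamari_interval_int_over_list[of Js] tamari_interval_int_over_list[OF assms(3,4)]
    by auto
  with cons show ?case by (simp add: int_over_list_Cons int_over_assoc)
qed

lemma maximal_decomposition_append:
  assumes "maximal_decomposition Js J" "maximal_decomposition Ks K"
  shows "maximal_decomposition (Js @ Ks) (int_over J K)"
  using assms unfolding maximal_decomposition_def decomposition_def
  by (auto simp: int_over_list_append)

lemma maximal_decomposition_exists:
  assumes "n \<ge> 1" "tamari_interval n I"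
  shows "\<exists>Is. maximal_decomposition Is I"
  using assms
proof (induction n arbitrary: I rule: less_induct)
  case (less n)
  show ?case
  proof (cases "int_decomposable I")
    case True
    then obtain p q J K where pq: "p \<ge> 1" "q \<ge> 1" "tamari_interval p J" "tamari_interval q K"
      and I: "I = int_over J K"
      unfolding int_decomposable_def by blast
    then have "n = p + q"
      using less.prems(2) tamari_interval_int_over(1) tamari_interval_size_unique by blast
    with pq have "p < n" "q < n" by simp_all
    with less.IH pq show ?thesis
      unfolding I by (meson maximal_decomposition_append)
  next
    case False
    with less.prems have "maximal_decomposition [I] I"
      by (auto simp: maximal_decomposition_def decomposition_def)
    then show ?thesis by blast
  qed
qed

lemma maximal_decomposition_Cons_cases:
  assumes "maximal_decomposition (J # Js) I"
  obtains (single) "Js = []" "I = J" "\<not> int_decomposable I"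
    | (product) p q K where "p \<ge> 1" "q \<ge> 1" "tamari_interval p J" "\<not> int_decomposable J"
      "tamari_interval q K" "maximal_decomposition Js K" "I = int_over J K"
proof (cases "Js = []")
  case True
  with assms single show thesis
    by (auto simp: maximal_decomposition_def decomposition_def)
next
  case False
  then obtain q where "q \<ge> 1" "tamari_interval q (int_over_list Js)"
    using assms tamari_interval_int_over_list[of Js]
    by (auto simp: maximal_decomposition_def decomposition_def)
  with assms False product[of _ q "int_over_list Js"] show thesis
    by (auto simp: maximal_decomposition_def decomposition_def int_over_list_Cons)
qed

lemma maximal_decomposition_unique:
  assumes "maximal_decomposition Js I" "maximal_decomposition Ks I"
  shows "Js = Ks"
  using assms
proof (induction Js arbitrary: I Ks)
  case Nil
  then show ?case by (simp add: maximal_decomposition_def decomposition_def)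
next
  case (Cons J Js)
  from Cons.prems(2) obtain K Ks' where Ks: "Ks = K # Ks'"
    by (cases Ks) (auto simp: maximal_decomposition_def decomposition_def)
  note K = Cons.prems(2)[unfolded Ks]
  from Cons.prems(1) show ?case
  proof (cases rule: maximal_decomposition_Cons_cases)
    case single
    from K show ?thesis
    proof (cases rule: maximal_decomposition_Cons_cases)
      case single
      with \<open>Js = []\<close> \<open>I = J\<close> Ks show ?thesis by simp
    next
      case product
      with \<open>\<not> int_decomposable I\<close> show ?thesis
        unfolding int_decomposable_def by blast
    qed
  next
    case J: (product p q M)
    from K show ?thesis
    proof (cases rule: maximal_decomposition_Cons_cases)
      case single
      with J show ?thesis
        unfolding int_decomposable_def by blast
    next
      case (product p' q' M')
      with J have "int_over J M = int_over K M'" by simp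
      with J product have "J = K" "M = M'"
        using int_over_indecomposable_cancel[of p J q M p' K q' M'] by blast+
      with Cons.IH[OF J(6)] product(6) Ks show ?thesis by simp
    qed
  qed
qed

theorem proposition4p4:
  fixes n :: nat and I :: "pbtree set"
  assumes "n \<ge> 1" and "tamari_interval n I"
  shows "\<exists>!Is. maximal_decomposition Is I"
  using maximal_decomposition_exists[OF assms] maximal_decomposition_unique by blast

end
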